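(* Let $K$ be a martingale kernel on $(0,\infty)$ and, for $x>0$, let $S=(S_k)_{k\in\mathbb{N}_0}$ be under $\mathbb{P}_x$ the positive Markov martingale with transition kernel $K$ started from $S_0=x$. Let $a(x):=\mathbb{P}_x[S_1<x]=K(x,(0,x))$ and, for $\epsilon>0$, $$b_\epsilon(x):=\mathbb{E}_x\Big[\frac{S_1}{x}\mathbf{1}_{\{S_1<x(1+\epsilon)\}}\Big]=\int_{(0,x(1+\epsilon))}\frac{y}{x}\,K(x,\mathrm{d}y),\quad x>0.$$ Suppose that there exists $x_a>0$ such that $\inf_{x\in[x_a,y]}a(x)>0$ for all $y>x_a$, and that there exist $\epsilon>0$ and $x_b>0$ such that $b_\epsilon$ is nonincreasing on $[x_b,\infty)$ and satisfies $\int_{\log(x_b)}^\infty b_\epsilon(\exp(u))\,\mathrm{d}u<\infty$. Then $S$ is a bubble under each $\mathbb{P}_x$, $x>0$, for which $S$ is not $\mathbb{P}_x$-a.s. bounded.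
   Context: Martingale kernel: $K:(0,\infty)\times\mathcal{B}_{(0,\infty)}\to[0,\infty)$ is a Markov (probability) kernel on $(0,\infty)$ with $\int_{(0,\infty)}y\,K(x,\mathrm{d}y)=x$ for all $x>0$. For $x>0$, under $\mathbb{P}_x$ (with expectation $\mathbb{E}_x$) the process $S=(S_k)_{k\in\mathbb{N}_0}$ is the time-homogeneous Markov chain with $S_0=x$ and transition kernel $K$; it is a positive martingale, with $\mathbb{P}_x$-a.s. limit $S_\infty$. "$S$ is $\mathbb{P}_x$-a.s. bounded" means that there is a deterministic constant $C<\infty$ with $\mathbb{P}_x[S_k\le C \text{ for all } k\in\mathbb{N}_0]=1$. Definition (bubble): put $\tau_0:=0$ and $\tau_k:=\inf\{j>\tau_{k-1}: S_j<S_{j-1}\}$ for $k\in\mathbb{N}$ ($\inf\emptyset=\infty$), and $S_{\tau_k}:=S_\infty$ on $\{\tau_k=\infty\}$. $S$ is a bubble under $\mathbb{P}_x$ (equivalently $\mathbb{P}_x$ is a bubble measure for $S$) if $\mathbb{E}_x[S_{\tau_k}]<\mathbb{E}_x[S_0]=x$ for some $k\in\mathbb{N}$. *)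

theory Defs
  imports "HOL-Probability.Probability"
begin

abbreviation pos_borel :: "real measure" where
  "pos_borel \<equiv> restrict_space borel {0<..}"

definition martingale_kernel :: "(real \<Rightarrow> real measure) \<Rightarrow> bool" where
  "martingale_kernel K \<longleftrightarrow>
     K \<in> pos_borel \<rightarrow>\<^sub>M prob_algebra pos_borel \<and>
     (\<forall>x>0. has_bochner_integral (K x) (\<lambda>y. y) x)"

definition natural_filtration :: "'w measure \<Rightarrow> (nat \<Rightarrow> 'w \<Rightarrow> real) \<Rightarrow> nat \<Rightarrow> 'w measure" where
  "natural_filtration M S n =
     sigma (space M) {S i -` A \<inter> space M | i A. i \<le> n \<and> A \<in> sets pos_borel}"

lemma subalgebra_natural_filtration:
  assumes "\<And>n. S n \<in> M \<rightarrow>\<^sub>M pos_borel"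
  shows "subalgebra M (natural_filtration M S n)"
proof -
  have *: "{S i -` A \<inter> space M | i A. i \<le> n \<and> A \<in> sets pos_borel} \<subseteq> sets M"
    using assms by (auto intro: measurable_sets)
  hence "{S i -` A \<inter> space M | i A. i \<le> n \<and> A \<in> sets pos_borel} \<subseteq> Pow (space M)"
    using sets.space_closed[of M] by blast
  thus ?thesis
    unfolding subalgebra_def natural_filtration_def
    using sets.sigma_sets_subset[OF *]
    by (simp add: space_measure_of_conv sets_measure_of)
qed

definition markov_chain_from ::
    "(real \<Rightarrow> real measure) \<Rightarrow> real \<Rightarrow> 'w measure \<Rightarrow> (nat \<Rightarrow> 'w \<Rightarrow> real) \<Rightarrow> bool" where
  "markov_chain_from K x M S \<longleftrightarrow>
     prob_space M \<and>
     (\<forall>n. S n \<in> M \<rightarrow>\<^sub>M pos_borel) \<and>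
     (AE \<omega> in M. S 0 \<omega> = x) \<and>
     (\<forall>n. \<forall>B\<in>sets pos_borel. AE \<omega> in M.
        real_cond_exp M (natural_filtration M S n) (\<lambda>\<omega>. indicator B (S (Suc n) \<omega>)) \<omega>
          = measure (K (S n \<omega>)) B)"

definition as_bounded :: "'w measure \<Rightarrow> (nat \<Rightarrow> 'w \<Rightarrow> real) \<Rightarrow> bool" where
  "as_bounded M S \<longleftrightarrow> (\<exists>C. AE \<omega> in M. \<forall>k. S k \<omega> \<le> C)"

text \<open>The almost sure limit of a positive martingale; the value is unspecified on the null set
  where the path does not converge.\<close>

definition S_infty :: "(nat \<Rightarrow> 'w \<Rightarrow> real) \<Rightarrow> 'w \<Rightarrow> real" where
  "S_infty S \<omega> = lim (\<lambda>n. S n \<omega>)"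

text \<open>Since \<open>tau S k \<omega> \<ge> 0\<close>, every \<open>j\<close> in the set below is positive, so the truncated
  subtraction \<open>j - 1\<close> is harmless. The infimum of the empty set in \<^typ>\<open>enat\<close> is \<open>\<infinity>\<close>.\<close>

primrec tau :: "(nat \<Rightarrow> 'w \<Rightarrow> real) \<Rightarrow> nat \<Rightarrow> 'w \<Rightarrow> enat" where
  "tau S 0 \<omega> = 0"
| "tau S (Suc k) \<omega> = Inf {enat j | j. tau S k \<omega> < enat j \<and> S j \<omega> < S (j - 1) \<omega>}"

definition value_at :: "(nat \<Rightarrow> 'w \<Rightarrow> real) \<Rightarrow> ('w \<Rightarrow> enat) \<Rightarrow> 'w \<Rightarrow> real" where
  "value_at S T \<omega> = (case T \<omega> of enat j \<Rightarrow> S j \<omega> | \<infinity> \<Rightarrow> S_infty S \<omega>)"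

text \<open>The expectations are those of almost surely nonnegative random variables, hence are written
  as nonnegative integrals: unlike the Bochner integral, these do not take the value 0 on
  nonintegrable functions.\<close>

definition bubble :: "'w measure \<Rightarrow> (nat \<Rightarrow> 'w \<Rightarrow> real) \<Rightarrow> bool" where
  "bubble M S \<longleftrightarrow>
     (\<exists>k\<ge>1. (\<integral>\<^sup>+ \<omega>. ennreal (value_at S (tau S k) \<omega>) \<partial>M) < (\<integral>\<^sup>+ \<omega>. ennreal (S 0 \<omega>) \<partial>M))"

definition down_prob :: "(real \<Rightarrow> real measure) \<Rightarrow> real \<Rightarrow> real" where
  "down_prob K x = measure (K x) {0<..<x}"

definition b_fun :: "(real \<Rightarrow> real measure) \<Rightarrow> real \<Rightarrow> real \<Rightarrow> real" where
  "b_fun K \<epsilon> x = (LINT y:{0<..<x * (1 + \<epsilon>)}|K x. y / x)"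

end

theory Submission
  imports Defs
begin

text \<open>Weight paths by \<open>S\<close>, i.e. pass to the measure with density process \<open>S\<close>. Under it, a step from \<open>z\<close>
  fails to multiply the state by \<open>1 + \<epsilon>\<close> with probability \<open>b\<^sub>\<epsilon>(z)\<close>. By monotonicity and integrability
  of \<open>b\<^sub>\<epsilon>\<close> these probabilities are summable along geometric sequences, so from a high enough level the
  chain grows forever with weight at least one half, without any down step. Under the original
  measure, however, the lower bound on \<open>a\<close> over compact intervals and the almost sure boundedness of
  paths without down steps force a down step almost surely. Hence the weight that never sees the next
  down time is lost in the limit, and Fatou's lemma turns this into a strict drop of the
  expectation at \<open>\<tau>\<^sub>k\<close>, where \<open>k - 1\<close> is a possible number of down times before a time at which the level
  is exceeded.\<close>

section \<open>The natural filtration and the pathwise combinatorics of down times\<close>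

lemma space_natural_filtration [simp]: "space (natural_filtration M S n) = space M"
  by (simp add: natural_filtration_def space_measure_of_conv)

lemma natural_filtration_mono:
  assumes "m \<le> n"
  shows "sets (natural_filtration M S m) \<subseteq> sets (natural_filtration M S n)"
proof -
  have "{S i -` A \<inter> space M | i A. i \<le> m \<and> A \<in> sets pos_borel}
      \<subseteq> {S i -` A \<inter> space M | i A. i \<le> n \<and> A \<in> sets pos_borel}"
    using assms order_trans by blast
  then show ?thesis
    unfolding natural_filtration_def
    by (subst (1 2) sets_measure_of) (auto intro!: sigma_sets_mono')
qed

text \<open>A nonempty infimum in \<open>enat\<close> is attained, so reaching the next down time by
  \<open>m\<close> is a finite search. Writing the down time as \<open>Suc i\<close> removes both
  the infimum and the truncated subtraction and turns the strict inequality
  \<open>tau S k \<omega> < enat j\<close> into \<open>tau S k \<omega> \<le> enat i\<close>; all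
  later arguments about \<open>tau\<close> use this form.\<close>

lemma tau_Suc_le_iff:
  "tau S (Suc k) \<omega> \<le> enat m \<longleftrightarrow> (\<exists>i<m. tau S k \<omega> \<le> enat i \<and> S (Suc i) \<omega> < S i \<omega>)"
proof -
  let ?D = "{enat j | j. tau S k \<omega> < enat j \<and> S j \<omega> < S (j - 1) \<omega>}"
  have "tau S (Suc k) \<omega> \<le> enat m \<longleftrightarrow> (\<exists>j\<le>m. tau S k \<omega> < enat j \<and> S j \<omega> < S (j - 1) \<omega>)"
  proof
    assume *: "tau S (Suc k) \<omega> \<le> enat m"
    then have ne: "?D \<noteq> {}"
      by (auto simp: Inf_enat_def split: if_splits)
    then have "Inf ?D \<in> ?D"
      unfolding Inf_enat_def by (simp only: if_False) (meson LeastI ex_in_conv)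
    with * show "\<exists>j\<le>m. tau S k \<omega> < enat j \<and> S j \<omega> < S (j - 1) \<omega>"
      by auto
  next
    assume "\<exists>j\<le>m. tau S k \<omega> < enat j \<and> S j \<omega> < S (j - 1) \<omega>"
    then obtain j where j: "j \<le> m" "enat j \<in> ?D" by auto
    then have "Inf ?D \<le> enat j" by (intro Inf_lower)
    with j(1) show "tau S (Suc k) \<omega> \<le> enat m"
      using order_trans by fastforce
  qed
  also have "\<dots> \<longleftrightarrow> (\<exists>i<m. tau S k \<omega> \<le> enat i \<and> S (Suc i) \<omega> < S i \<omega>)"
  proof
    assume "\<exists>j\<le>m. tau S k \<omega> < enat j \<and> S j \<omega> < S (j - 1) \<omega>"
    then obtain j where j: "j \<le> m" "tau S k \<omega> < enat j" "S j \<omega> < S (j - 1) \<omega>" by blast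
    then obtain i where "j = Suc i" by (cases j) auto
    with j show "\<exists>i<m. tau S k \<omega> \<le> enat i \<and> S (Suc i) \<omega> < S i \<omega>"
      by (intro exI[of _ i], cases "tau S k \<omega>") auto
  next
    assume "\<exists>i<m. tau S k \<omega> \<le> enat i \<and> S (Suc i) \<omega> < S i \<omega>"
    then obtain i where "i < m" "tau S k \<omega> \<le> enat i" "S (Suc i) \<omega> < S i \<omega>" by blast
    then show "\<exists>j\<le>m. tau S k \<omega> < enat j \<and> S j \<omega> < S (j - 1) \<omega>"
      by (intro exI[of _ "Suc i"]) (auto intro: le_less_trans)
  qed
  finally show ?thesis .
qed

declare tau.simps(2) [simp del]

lemma tau_ge: "enat k \<le> tau S k \<omega>"
proof (induction k)
  case (Suc k)
  have "\<not> tau S (Suc k) \<omega> \<le> enat k"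
    using Suc tau_Suc_le_iff[of S k \<omega> k] by (meson enat_ord_simps(1) leD order_trans)
  then show ?case
    by (simp add: Suc_ile_eq)
qed (simp add: zero_enat_def)

text \<open>Down times are strictly increasing integers while finite, so only finitely many occur by
  time \<open>n\<close>. This splits any event at time \<open>n\<close> into countably many pieces
  according to the number of down steps so far.\<close>

lemma tau_interval_exists: "\<exists>j. tau S j \<omega> \<le> enat n \<and> \<not> tau S (Suc j) \<omega> \<le> enat n"
proof (rule ccontr)
  assume *: "\<not> ?thesis"
  have "tau S j \<omega> \<le> enat n" for j
    using * by (induction j) auto
  then show False
    using tau_ge[of "Suc n" S \<omega>] by (meson Suc_ile_eq leD)
qed

text \<open>After the last finite down time the path never falls again. Hence \<open>S_infty\<close>
  enters \<open>value_at\<close> only on eventually nondecreasing paths, and it is enough to prove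
  convergence there.\<close>

lemma tau_infty_eventually_incseq:
  assumes "tau S k \<omega> = \<infinity>"
  shows "\<exists>n. \<forall>m\<ge>n. S m \<omega> \<le> S (Suc m) \<omega>"
  using assms
proof (induction k)
  case (Suc k)
  show ?case
  proof (cases "tau S k \<omega>")
    case (enat n)
    have "S m \<omega> \<le> S (Suc m) \<omega>" if "n \<le> m" for m
      using tau_Suc_le_iff[of S k \<omega> "Suc m"] Suc.prems enat that by (auto simp: not_less)
    then show ?thesis by blast
  qed (use Suc in auto)
qed simp

section \<open>Comparison of an integral with a sum along a geometric sequence\<close>

text \<open>In the variable \<open>u = ln z\<close> the sample points are equally spaced with
  distance \<open>h = ln (1 + \<epsilon>)\<close>. On each cell the antitone \<open>f\<close> is at
  least its value at the right endpoint, so \<open>h\<close> times any partial sum is bounded by the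
  integral.\<close>

lemma summable_geometric_samples:
  fixes f :: "real \<Rightarrow> real"
  assumes "0 < \<epsilon>" "0 < b" and anti: "antimono_on {b..} f" and nonneg: "\<And>z. b \<le> z \<Longrightarrow> 0 \<le> f z"
    and fin: "(\<integral>\<^sup>+u\<in>{ln b..}. ennreal (f (exp u)) \<partial>lborel) < \<infinity>"
  shows "summable (\<lambda>i. f (b * (1 + \<epsilon>) ^ Suc i))"
proof -
  define h where "h = ln (1 + \<epsilon>)"
  have h: "0 < h" using assms(1) by (simp add: h_def)
  define z where "z i = b * (1 + \<epsilon>) ^ i" for i :: nat
  \<comment> \<open>The right endpoint of \<open>I i\<close> is \<open>ln (z (Suc i))\<close>, which
    is why the sum samples at \<open>Suc i\<close>; leaving out the left endpoint makes the cells
    disjoint.\<close>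
  define I where "I i = {ln b + real i * h<..ln b + real (Suc i) * h}" for i
  have exp_h: "exp (ln b + real i * h) = z i" for i
    using assms(1,2) by (simp add: exp_add exp_of_nat_mult h_def z_def)
  have zb: "b \<le> z i" for i
    using assms(1,2) by (simp add: z_def mult_le_cancel_left1 one_le_power)
  have disj: "disjoint_family I"
  proof -
    have "I i \<inter> I j = {}" if "i < j" for i j
    proof -
      have "real (Suc i) * h \<le> real j * h"
        using that h by (intro mult_right_mono) auto
      then show ?thesis by (auto simp: I_def)
    qed
    then show ?thesis
      unfolding disjoint_family_on_def by (metis Int_commute linorder_neqE_nat)
  qed
  have bound: "ennreal h * ennreal (\<Sum>i<n. f (z (Suc i)))
      \<le> (\<integral>\<^sup>+u\<in>{ln b..}. ennreal (f (exp u)) \<partial>lborel)" for n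
  proof -
    have "ennreal h * ennreal (\<Sum>i<n. f (z (Suc i))) = (\<Sum>i<n. ennreal (f (z (Suc i))) * emeasure lborel (I i))"
    proof -
      have "emeasure lborel (I i) = ennreal h" for i
        using h by (simp add: I_def distrib_right)
      moreover have "ennreal (\<Sum>i<n. f (z (Suc i))) = (\<Sum>i<n. ennreal (f (z (Suc i))))"
        by (rule sum_ennreal[symmetric]) (rule nonneg[OF zb])
      ultimately show ?thesis
        by (simp only: sum_distrib_left mult.commute)
    qed
    also have "\<dots> = (\<integral>\<^sup>+u. (\<Sum>i<n. ennreal (f (z (Suc i))) * indicator (I i) u) \<partial>lborel)"
      by (subst nn_integral_sum) (auto simp: I_def nn_integral_cmult_indicator)
    also have "\<dots> \<le> (\<integral>\<^sup>+u\<in>{ln b..}. ennreal (f (exp u)) \<partial>lborel)"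
    proof (rule nn_integral_mono)
      fix u :: real
      show "(\<Sum>i<n. ennreal (f (z (Suc i))) * indicator (I i) u) \<le> ennreal (f (exp u)) * indicator {ln b..} u"
      proof (cases "\<exists>i<n. u \<in> I i")
        case True
        then obtain i where i: "i < n" "u \<in> I i" by blast
        \<comment> \<open>By disjointness only the cell containing \<open>u\<close> contributes, so
          the whole sum collapses to one value of \<open>f\<close>.\<close>
        have "indicator (I j) u = (if j = i then 1 else 0 :: ennreal)" for j
          using disj i(2) by (auto simp: disjoint_family_on_def indicator_def)
        then have "(\<Sum>j<n. ennreal (f (z (Suc j))) * indicator (I j) u) = ennreal (f (z (Suc i)))"
          using i(1) by (simp only: if_distrib[of "\<lambda>t. _ * t"] mult_1_right mult_zero_right sum.delta[OF finite_lessThan]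
              lessThan_iff if_True)
        moreover have "ln b \<le> u"
          using i(2) h by (auto simp: I_def intro: order_trans[of _ "ln b + real i * h"])
        moreover have "exp u \<le> z (Suc i)"
          using i(2) exp_h[of "Suc i"] exp_le_cancel_iff[of u "ln b + real (Suc i) * h"]
          unfolding I_def by simp
        moreover have "b \<le> exp u"
          using \<open>ln b \<le> u\<close> assms(2) by (metis exp_le_cancel_iff exp_ln)
        ultimately show ?thesis
          using monotone_onD[OF anti, of "exp u" "z (Suc i)"] zb[of "Suc i"] by (auto intro: ennreal_leI)
      qed (auto intro!: sum.neutral)
    qed
    finally show ?thesis .
  qed
  obtain r where r: "0 \<le> r" "(\<integral>\<^sup>+u\<in>{ln b..}. ennreal (f (exp u)) \<partial>lborel) = ennreal r"
    using fin by (metis enn2real_nonneg ennreal_enn2real infinity_ennreal_def)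
  have "h * (\<Sum>i<n. f (z (Suc i))) \<le> r" for n
    using bound[of n] h r by (simp add: ennreal_mult''[symmetric] sum_nonneg nonneg zb)
  then have "(\<Sum>i<n. f (z (Suc i))) \<le> r / h" for n
    using h by (simp add: field_simps)
  then have "summable (\<lambda>i. f (z (Suc i)))"
    by (intro summableI_nonneg_bounded[of _ "r / h"]) (auto intro: nonneg zb)
  then show ?thesis by (simp add: z_def)
qed

section \<open>The chain, its kernel and one-step transitions\<close>

locale markov_martingale = prob_space M for M :: "'w measure" +
  fixes K :: "real \<Rightarrow> real measure" and S :: "nat \<Rightarrow> 'w \<Rightarrow> real" and x :: real
  assumes kernel: "martingale_kernel K"
    and chain: "markov_chain_from K x M S"
begin

abbreviation F :: "nat \<Rightarrow> 'w measure" where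
  "F n \<equiv> natural_filtration M S n"

lemma K_measurable [measurable]: "K \<in> pos_borel \<rightarrow>\<^sub>M subprob_algebra pos_borel"
  using kernel unfolding martingale_kernel_def by (auto intro: measurable_prob_algebraD)

lemma S_measurable_pos [measurable]: "S n \<in> M \<rightarrow>\<^sub>M pos_borel"
  using chain unfolding markov_chain_from_def by auto

lemma S_measurable [measurable]: "S n \<in> borel_measurable M"
  using S_measurable_pos[of n] by (simp add: measurable_restrict_space2_iff)

lemma S_pos: "\<omega> \<in> space M \<Longrightarrow> 0 < S n \<omega>"
  using measurable_space[OF S_measurable_pos[of n]] by (auto simp: space_restrict_space)

lemma S_measurable_F: "m \<le> n \<Longrightarrow> S m \<in> borel_measurable (F n)"
proof (rule measurableI)
  fix A :: "real set" assume A: "A \<in> sets borel" and mn: "m \<le> n"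
  have "A \<inter> {0<..} \<in> sets pos_borel"
    using A by (auto simp: sets_restrict_space)
  moreover have "S m -` A \<inter> space M = S m -` (A \<inter> {0<..}) \<inter> space M"
    using S_pos by auto
  ultimately have "S m -` A \<inter> space M \<in> {S i -` A \<inter> space M | i A. i \<le> n \<and> A \<in> sets pos_borel}"
    using mn by blast
  then show "S m -` A \<inter> space (F n) \<in> sets (F n)"
    unfolding natural_filtration_def
    by (subst sets_measure_of) (auto simp: space_measure_of_conv)
qed auto

lemma subalg: "subalgebra M (F n)"
  by (rule subalgebra_natural_filtration) simp

lemma sets_F: "A \<in> sets (F n) \<Longrightarrow> A \<in> sets M"
  using subalg[of n] by (auto simp: subalgebra_def)

lemma K_prob: "0 < z \<Longrightarrow> prob_space (K z)"
  using kernel measurable_space[of K pos_borel "prob_algebra pos_borel" z]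
  unfolding martingale_kernel_def by (auto simp: space_restrict_space space_prob_algebra)

lemma sets_K: "0 < z \<Longrightarrow> sets (K z) = sets pos_borel"
  using kernel measurable_space[of K pos_borel "prob_algebra pos_borel" z]
  unfolding martingale_kernel_def by (auto simp: space_restrict_space space_prob_algebra)

lemma space_K: "0 < z \<Longrightarrow> space (K z) = {0<..}"
  using sets_eq_imp_space_eq[OF sets_K, of z] by (simp add: space_restrict_space)

lemma K_mean: "0 < z \<Longrightarrow> (\<integral>\<^sup>+y. ennreal y \<partial>K z) = ennreal z"
  using kernel unfolding martingale_kernel_def
  by (intro nn_integral_eq_integrable[THEN iffD2] has_bochner_integral_iff[THEN iffD1])
     (auto simp: has_bochner_integral_iff space_K)

text \<open>The Markov property is given through conditional expectations of indicators; integrating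
  it over an event \<open>G\<close> of the past yields a form free of conditional expectations. Both
  indicators and kernel values lie in [0,1], so integrability is automatic.\<close>

lemma transition:
  assumes "G \<in> sets (F n)" "B \<in> sets pos_borel"
  shows "emeasure M (G \<inter> (S (Suc n) -` B \<inter> space M))
    = (\<integral>\<^sup>+\<omega>\<in>G. emeasure (K (S n \<omega>)) B \<partial>M)"
proof -
  interpret fs: finite_measure_subalgebra M "F n"
    by unfold_locales (rule subalg)
  note [measurable] = sets_F[OF assms(1)] assms(2)
  let ?I = "\<lambda>\<omega>. indicator B (S (Suc n) \<omega>) :: real"
  have [measurable]: "(\<lambda>\<omega>. measure (K (S n \<omega>)) B) \<in> borel_measurable M"
    by measurable
  have le1: "measure (K (S n \<omega>)) B \<le> 1" if "\<omega> \<in> space M" for \<omega>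
    by (rule prob_space.prob_le_1[OF K_prob[OF S_pos[OF that]]])
  have int: "integrable M ?I" by (rule integrable_const_bound[of _ 1]) (auto simp: indicator_def)
  have int': "set_integrable M G (\<lambda>\<omega>. measure (K (S n \<omega>)) B)"
    unfolding set_integrable_def
    by (rule integrable_const_bound[of _ 1]) (auto simp: indicator_def le1)
  have "emeasure M (G \<inter> (S (Suc n) -` B \<inter> space M))
      = ennreal (measure M (G \<inter> (S (Suc n) -` B \<inter> space M)))"
    by (simp add: emeasure_eq_measure)
  also have "measure M (G \<inter> (S (Suc n) -` B \<inter> space M)) = (LINT \<omega>:G|M. ?I \<omega>)"
  proof -
    have "(LINT \<omega>:G|M. ?I \<omega>) = (LINT \<omega>|M. indicator (G \<inter> (S (Suc n) -` B \<inter> space M)) \<omega>)"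
      unfolding set_lebesgue_integral_def
      by (intro Bochner_Integration.integral_cong) (auto simp: indicator_def)
    then show ?thesis by simp
  qed
  also have "\<dots> = (LINT \<omega>:G|M. real_cond_exp M (F n) ?I \<omega>)"
    by (rule fs.real_cond_exp_intA[OF int assms(1)])
  also have "\<dots> = (LINT \<omega>:G|M. measure (K (S n \<omega>)) B)"
  proof -
    have "AE \<omega> in M. real_cond_exp M (F n) ?I \<omega> = measure (K (S n \<omega>)) B"
      using chain assms(2) unfolding markov_chain_from_def by auto
    then show ?thesis
      unfolding set_lebesgue_integral_def
      by (intro integral_cong_AE) auto
  qed
  also have "ennreal \<dots> = (\<integral>\<^sup>+\<omega>. ennreal (indicator G \<omega> * measure (K (S n \<omega>)) B) \<partial>M)"
    using int' unfolding set_lebesgue_integral_def set_integrable_def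
    by (subst nn_integral_eq_integral) auto
  also have "\<dots> = (\<integral>\<^sup>+\<omega>\<in>G. emeasure (K (S n \<omega>)) B \<partial>M)"
  proof (rule nn_integral_cong)
    fix \<omega> assume "\<omega> \<in> space M"
    then interpret k: prob_space "K (S n \<omega>)" by (intro K_prob S_pos)
    show "ennreal (indicator G \<omega> * measure (K (S n \<omega>)) B)
        = emeasure (K (S n \<omega>)) B * indicator G \<omega>"
      by (auto simp: indicator_def k.emeasure_eq_measure)
  qed
  finally show ?thesis .
qed

text \<open>Both sides integrate \<open>f\<close> against a finite measure on pairs (present, next
  state). These measures agree on rectangles by \<open>transition\<close>, and rectangles form an
  intersection-stable generator. Letting \<open>f\<close> depend on the present state covers events
  such as a jump by a factor \<open>1 + \<epsilon>\<close>.\<close>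

lemma nn_integral_transition:
  assumes G: "G \<in> sets (F n)"
    and f: "case_prod f \<in> borel_measurable (pos_borel \<Otimes>\<^sub>M pos_borel)"
  shows "(\<integral>\<^sup>+\<omega>\<in>G. f (S n \<omega>) (S (Suc n) \<omega>) \<partial>M)
    = (\<integral>\<^sup>+\<omega>\<in>G. (\<integral>\<^sup>+y. f (S n \<omega>) y \<partial>K (S n \<omega>)) \<partial>M)"
proof -
  note [measurable] = sets_F[OF G] f measurable_distr2
  let ?P = "pos_borel \<Otimes>\<^sub>M pos_borel"
  \<comment> \<open>\<open>?G\<close> is \<open>M\<close> restricted to \<open>G\<close>, and
    \<open>?k \<omega>\<close> below is the product of the Dirac mass at \<open>S n \<omega>\<close>
    with \<open>K (S n \<omega>)\<close>. The claim becomes an identity between a joint law and a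
    kernel mixture.\<close>
  let ?G = "density M (indicator G)"
  let ?k = "\<lambda>\<omega>. distr (K (S n \<omega>)) ?P (Pair (S n \<omega>))"
  have kG: "?k \<in> M \<rightarrow>\<^sub>M subprob_algebra ?P"
    by (rule measurable_compose[OF S_measurable_pos[of n], of "\<lambda>z. distr (K z) ?P (Pair z)"]) measurable
  then have k: "?k \<in> ?G \<rightarrow>\<^sub>M subprob_algebra ?P"
    by simp
  have kf: "(\<lambda>\<omega>. \<integral>\<^sup>+y. f (S n \<omega>) y \<partial>K (S n \<omega>)) \<in> borel_measurable M"
    by (rule measurable_compose[OF S_measurable_pos[of n], of "\<lambda>z. \<integral>\<^sup>+y. f z y \<partial>K z"])
       (rule nn_integral_measurable_subprob_algebra2[OF f K_measurable])
  have Pair: "Pair z \<in> K z \<rightarrow>\<^sub>M ?P" if "0 < z" for z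
    using that by (auto simp: measurable_cong_sets[OF sets_K[OF that] refl] space_restrict_space)
  have "distr ?G ?P (\<lambda>\<omega>. (S n \<omega>, S (Suc n) \<omega>)) = ?G \<bind> ?k"
  proof (rule measure_eqI_generator_eq[OF Int_stable_pair_measure_generator[of pos_borel pos_borel]])
    show "{a \<times> b |a b. a \<in> sets pos_borel \<and> b \<in> sets pos_borel} \<subseteq> Pow ({0<..} \<times> {0<..})"
      using sets.sets_into_space[of _ pos_borel] by (fastforce simp: space_restrict_space)
    show "sets (distr ?G ?P (\<lambda>\<omega>. (S n \<omega>, S (Suc n) \<omega>)))
        = sigma_sets ({0<..} \<times> {0<..}) {a \<times> b |a b. a \<in> sets pos_borel \<and> b \<in> sets pos_borel}"
      by (simp add: sets_pair_measure space_restrict_space)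
    show "sets (?G \<bind> ?k)
        = sigma_sets ({0<..} \<times> {0<..}) {a \<times> b |a b. a \<in> sets pos_borel \<and> b \<in> sets pos_borel}"
      by (subst sets_bind[of _ _ ?P]) (auto simp: sets_pair_measure space_restrict_space not_empty)
    show "range (\<lambda>_::nat. {0<..} \<times> {0<..})
        \<subseteq> {a \<times> b |a b. a \<in> sets pos_borel \<and> b \<in> sets pos_borel}"
      using sets.top[of pos_borel] by (auto simp: space_restrict_space)
    show "emeasure (distr ?G ?P (\<lambda>\<omega>. (S n \<omega>, S (Suc n) \<omega>))) ({0<..} \<times> {0<..}) \<noteq> \<infinity>"
    proof -
      have "emeasure (distr ?G ?P (\<lambda>\<omega>. (S n \<omega>, S (Suc n) \<omega>))) ({0<..} \<times> {0<..})
          \<le> emeasure ?G (space ?G)"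
        using sets.top[of ?P]
        by (subst emeasure_distr)
           (simp_all add: space_pair_measure space_restrict_space emeasure_space del: space_density)
      also have "\<dots> = emeasure M (G \<inter> space M)"
        by (simp add: emeasure_density)
      finally show ?thesis
        by (metis emeasure_finite infinity_ennreal_def neq_top_trans)
    qed
    fix X assume "X \<in> {a \<times> b |a b. a \<in> sets pos_borel \<and> b \<in> sets pos_borel}"
    then obtain A B where X: "X = A \<times> B" and [measurable]: "A \<in> sets pos_borel" "B \<in> sets pos_borel"
      by blast
    have "emeasure (distr ?G ?P (\<lambda>\<omega>. (S n \<omega>, S (Suc n) \<omega>))) X
        = emeasure ?G ((S n -` A \<inter> space M) \<inter> (S (Suc n) -` B \<inter> space M))"
      unfolding X by (subst emeasure_distr) (auto intro!: arg_cong[where f="emeasure ?G"])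
    also have "\<dots> = (\<integral>\<^sup>+\<omega>. indicator G \<omega>
        * indicator ((S n -` A \<inter> space M) \<inter> (S (Suc n) -` B \<inter> space M)) \<omega> \<partial>M)"
      by (rule emeasure_density) auto
    also have "\<dots> = (\<integral>\<^sup>+\<omega>. indicator ((G \<inter> (S n -` A \<inter> space M)) \<inter> (S (Suc n) -` B \<inter> space M)) \<omega> \<partial>M)"
      by (intro nn_integral_cong) (auto simp: indicator_def)
    also have "\<dots> = emeasure M ((G \<inter> (S n -` A \<inter> space M)) \<inter> (S (Suc n) -` B \<inter> space M))"
      by (rule nn_integral_indicator) auto
    \<comment> \<open>The first side of the rectangle constrains only \<open>S n\<close>, so it is
      absorbed into the event of the past; \<open>transition\<close> then handles the second
      side.\<close>
    also have "\<dots> = (\<integral>\<^sup>+\<omega>\<in>G \<inter> (S n -` A \<inter> space M). emeasure (K (S n \<omega>)) B \<partial>M)"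
    proof (rule transition)
      have "S n -` A \<inter> space (F n) \<in> sets (F n)"
        using S_measurable_F[of n n] \<open>A \<in> sets pos_borel\<close>
        by (intro measurable_sets[of _ _ borel]) (auto simp: sets_restrict_space)
      then show "G \<inter> (S n -` A \<inter> space M) \<in> sets (F n)"
        using G by auto
    qed simp
    also have "\<dots> = (\<integral>\<^sup>+\<omega>. emeasure (?k \<omega>) X \<partial>?G)"
    proof (subst nn_integral_density)
      show "(\<lambda>\<omega>. emeasure (?k \<omega>) X) \<in> borel_measurable M"
        using kG X by (auto intro: measurable_emeasure_kernel)
      show "(\<integral>\<^sup>+\<omega>\<in>G \<inter> (S n -` A \<inter> space M). emeasure (K (S n \<omega>)) B \<partial>M)
          = (\<integral>\<^sup>+\<omega>. indicator G \<omega> * emeasure (?k \<omega>) X \<partial>M)"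
      proof (rule nn_integral_cong)
        fix \<omega> assume w: "\<omega> \<in> space M"
        have "B \<subseteq> space (K (S n \<omega>))"
          using sets.sets_into_space[of B pos_borel] by (simp add: space_K[OF S_pos[OF w]] space_restrict_space)
        then have "emeasure (?k \<omega>) X = indicator A (S n \<omega>) * emeasure (K (S n \<omega>)) B"
          unfolding X
          by (subst emeasure_distr[OF Pair[OF S_pos[OF w]]])
             (auto simp: indicator_def intro!: arg_cong[where f="emeasure (K (S n \<omega>))"])
        then show "emeasure (K (S n \<omega>)) B * indicator (G \<inter> (S n -` A \<inter> space M)) \<omega>
            = indicator G \<omega> * emeasure (?k \<omega>) X"
          using w by (auto simp: indicator_def)
      qed
    qed auto
    also have "\<dots> = emeasure (?G \<bind> ?k) X"
      unfolding X using k by (subst emeasure_bind[of _ _ ?P]) (auto simp: not_empty)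
    finally show "emeasure (distr ?G ?P (\<lambda>\<omega>. (S n \<omega>, S (Suc n) \<omega>))) X = emeasure (?G \<bind> ?k) X" .
  qed auto
  then have "(\<integral>\<^sup>+p. case_prod f p \<partial>distr ?G ?P (\<lambda>\<omega>. (S n \<omega>, S (Suc n) \<omega>)))
      = (\<integral>\<^sup>+p. case_prod f p \<partial>(?G \<bind> ?k))"
    by simp
  also have "\<dots> = (\<integral>\<^sup>+\<omega>. \<integral>\<^sup>+p. case_prod f p \<partial>?k \<omega> \<partial>?G)"
    by (rule nn_integral_bind[OF f k])
  also have "\<dots> = (\<integral>\<^sup>+\<omega>. (\<integral>\<^sup>+y. f (S n \<omega>) y \<partial>K (S n \<omega>)) \<partial>?G)"
    by (intro nn_integral_cong) (simp add: S_pos nn_integral_distr Pair)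
  also have "\<dots> = (\<integral>\<^sup>+\<omega>\<in>G. (\<integral>\<^sup>+y. f (S n \<omega>) y \<partial>K (S n \<omega>)) \<partial>M)"
    by (subst nn_integral_density[OF _ kf]) (auto simp: mult.commute)
  finally show ?thesis
    by (simp add: nn_integral_distr nn_integral_density mult.commute)
qed

lemma martingale_step:
  assumes "G \<in> sets (F n)"
  shows "(\<integral>\<^sup>+\<omega>\<in>G. ennreal (S (Suc n) \<omega>) \<partial>M) = (\<integral>\<^sup>+\<omega>\<in>G. ennreal (S n \<omega>) \<partial>M)"
proof -
  have [measurable]: "(\<lambda>y. y) \<in> borel_measurable pos_borel"
    by (simp add: measurable_restrict_space1)
  have "(\<integral>\<^sup>+\<omega>\<in>G. ennreal (S (Suc n) \<omega>) \<partial>M) = (\<integral>\<^sup>+\<omega>\<in>G. (\<integral>\<^sup>+y. ennreal y \<partial>K (S n \<omega>)) \<partial>M)"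
    using nn_integral_transition[OF assms, of "\<lambda>_ y. ennreal y"] by simp
  also have "\<dots> = (\<integral>\<^sup>+\<omega>\<in>G. ennreal (S n \<omega>) \<partial>M)"
    by (intro nn_integral_cong) (simp add: K_mean S_pos)
  finally show ?thesis .
qed

section \<open>Stopping at down times and convergence of eventually nondecreasing paths\<close>

text \<open>Down times are stopping times: by \<open>tau_Suc_le_iff\<close> the event is a finite
  union over \<open>i < m\<close>, each piece looking no further than time
  \<open>Suc i \<le> m\<close>. The induction keeps \<open>m\<close> general because the previous
  down time is tested at the earlier time \<open>i\<close>.\<close>

lemma tau_le_sets: "{\<omega>\<in>space M. tau S k \<omega> \<le> enat m} \<in> sets (F m)"
proof (induction k arbitrary: m)
  case 0
  show ?case using sets.top[of "F m"] by (simp add: zero_enat_def)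
next
  case (Suc k)
  have "{\<omega>\<in>space M. tau S k \<omega> \<le> enat i \<and> S (Suc i) \<omega> < S i \<omega>} \<in> sets (F m)" if "i < m" for i
  proof -
    have [measurable]: "S i \<in> borel_measurable (F m)" "S (Suc i) \<in> borel_measurable (F m)"
      using that by (auto intro: S_measurable_F)
    have "{\<omega>\<in>space (F m). S (Suc i) \<omega> < S i \<omega>} \<in> sets (F m)"
      by measurable
    moreover have "{\<omega>\<in>space M. tau S k \<omega> \<le> enat i} \<in> sets (F m)"
      using Suc[of i] natural_filtration_mono[of i m M S] that by auto
    ultimately have "{\<omega>\<in>space M. tau S k \<omega> \<le> enat i} \<inter> {\<omega>\<in>space (F m). S (Suc i) \<omega> < S i \<omega>} \<in> sets (F m)"
      by auto
    then show ?thesis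
      by (simp add: Collect_conj_eq Int_assoc) (simp add: Int_ac)
  qed
  then have "(\<Union>i<m. {\<omega>\<in>space M. tau S k \<omega> \<le> enat i \<and> S (Suc i) \<omega> < S i \<omega>}) \<in> sets (F m)"
    by (intro sets.finite_UN) auto
  moreover have "(\<Union>i<m. {\<omega>\<in>space M. tau S k \<omega> \<le> enat i \<and> S (Suc i) \<omega> < S i \<omega>})
      = {\<omega>\<in>space M. tau S (Suc k) \<omega> \<le> enat m}"
    by (auto simp: tau_Suc_le_iff)
  ultimately show ?case by simp
qed

lemma nn_integral_start: "(\<integral>\<^sup>+\<omega>. ennreal (S 0 \<omega>) \<partial>M) = ennreal x"
proof -
  have "AE \<omega> in M. S 0 \<omega> = x"
    using chain unfolding markov_chain_from_def by auto
  then have "(\<integral>\<^sup>+\<omega>. ennreal (S 0 \<omega>) \<partial>M) = (\<integral>\<^sup>+\<omega>. ennreal x \<partial>M)"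
    by (intro nn_integral_cong_AE) auto
  then show ?thesis by (simp add: emeasure_space_1)
qed

lemma nn_integral_S: "(\<integral>\<^sup>+\<omega>. ennreal (S n \<omega>) \<partial>M) = ennreal x"
proof (induction n)
  case (Suc n)
  have "(\<integral>\<^sup>+\<omega>. ennreal (S (Suc n) \<omega>) \<partial>M) = (\<integral>\<^sup>+\<omega>\<in>space M. ennreal (S (Suc n) \<omega>) \<partial>M)"
    by (intro nn_integral_cong) auto
  also have "\<dots> = (\<integral>\<^sup>+\<omega>\<in>space M. ennreal (S n \<omega>) \<partial>M)"
    using sets.top[of "F n"] by (intro martingale_step) simp
  also have "\<dots> = (\<integral>\<^sup>+\<omega>. ennreal (S n \<omega>) \<partial>M)"
    by (intro nn_integral_cong) auto
  finally show ?case using Suc by simp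
qed (rule nn_integral_start)

text \<open>Fatou's lemma and the constant expectation give an almost surely finite lower limit. A
  nondecreasing tail that is unbounded would have lower limit infinity, so almost surely such a tail
  is bounded and converges.\<close>

lemma AE_convergent_if_eventually_incseq:
  "AE \<omega> in M. (\<exists>n. \<forall>m\<ge>n. S m \<omega> \<le> S (Suc m) \<omega>) \<longrightarrow> convergent (\<lambda>m. S m \<omega>)"
proof -
  have "(\<integral>\<^sup>+\<omega>. liminf (\<lambda>m. ennreal (S m \<omega>)) \<partial>M) \<le> liminf (\<lambda>m. \<integral>\<^sup>+\<omega>. ennreal (S m \<omega>) \<partial>M)"
    by (rule nn_integral_liminf) auto
  also have "\<dots> = ennreal x"
    by (simp add: nn_integral_S Liminf_const)
  finally have "AE \<omega> in M. liminf (\<lambda>m. ennreal (S m \<omega>)) \<noteq> \<infinity>"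
    by (intro nn_integral_PInf_AE) (auto simp: top_unique)
  then show ?thesis
  proof eventually_elim
    case (elim \<omega>)
    show ?case
    proof
      assume "\<exists>n. \<forall>m\<ge>n. S m \<omega> \<le> S (Suc m) \<omega>"
      then obtain n where n: "\<And>m. n \<le> m \<Longrightarrow> S m \<omega> \<le> S (Suc m) \<omega>" by blast
      have inc: "incseq (\<lambda>i. S (i + n) \<omega>)"
        by (intro incseq_SucI) (simp add: n)
      have "\<exists>C. \<forall>i. S (i + n) \<omega> \<le> C"
      proof (rule ccontr)
        assume *: "\<nexists>C. \<forall>i. S (i + n) \<omega> \<le> C"
        have "filterlim (\<lambda>i. S (i + n) \<omega>) at_top sequentially"
          unfolding filterlim_at_top
        proof
          fix C
          obtain i where i: "C < S (i + n) \<omega>" using * by (meson not_le)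
          show "\<forall>\<^sub>F i in sequentially. C \<le> S (i + n) \<omega>"
            using i incseqD[OF inc, of i]
            by (intro eventually_sequentiallyI[of i]) (meson less_le_trans less_imp_le)
        qed
        then have "filterlim (\<lambda>i. S i \<omega>) at_top sequentially"
          unfolding filterlim_at_top
          by (subst (asm) eventually_sequentially_seg[where P="\<lambda>i. Z \<le> S i \<omega>" for Z])
        then have "(\<lambda>i. ennreal (S i \<omega>)) \<longlonglongrightarrow> \<infinity>"
          by (simp add: ennreal_tendsto_top_eq_at_top)
        then have "liminf (\<lambda>i. ennreal (S i \<omega>)) = \<infinity>"
          by (intro lim_imp_Liminf) auto
        with elim show False by simp
      qed
      then obtain C where C: "\<And>i. S (i + n) \<omega> \<le> C" by blast
      have "convergent (\<lambda>i. S (i + n) \<omega>)"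
        by (rule incseq_convergent[OF inc, of C]) (use C in \<open>auto simp: convergent_def\<close>)
      then show "convergent (\<lambda>m. S m \<omega>)"
        by (subst (asm) convergent_ignore_initial_segment)
    qed
  qed
qed

definition stopped :: "nat \<Rightarrow> nat \<Rightarrow> 'w \<Rightarrow> real" where
  "stopped k m \<omega> = (case tau S k \<omega> of enat j \<Rightarrow> S (min j m) \<omega> | \<infinity> \<Rightarrow> S m \<omega>)"

lemma stopped_before: "\<not> tau S k \<omega> \<le> enat m \<Longrightarrow> stopped k m \<omega> = S m \<omega>"
  by (auto simp: stopped_def min_def split: enat.split)

lemma stopped_Suc:
  "stopped k (Suc m) \<omega> = (if tau S k \<omega> \<le> enat m then stopped k m \<omega> else S (Suc m) \<omega>)"
proof (cases "tau S k \<omega>")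
  case (enat j)
  then show ?thesis
    by (cases "j \<le> m") (auto simp: stopped_def min_def not_le le_Suc_eq)
qed (simp add: stopped_def)

lemma tau_le_events [measurable]: "Measurable.pred M (\<lambda>\<omega>. tau S k \<omega> \<le> enat m)"
  using sets_F[OF tau_le_sets] by (simp add: pred_def)

lemma stopped_measurable [measurable]: "stopped k m \<in> borel_measurable M"
proof (induction m)
  case 0
  have "stopped k 0 = S 0" by (auto simp: stopped_def fun_eq_iff split: enat.split)
  then show ?case by simp
next
  case (Suc m)
  note [measurable] = Suc
  show ?case unfolding stopped_Suc[abs_def] by measurable
qed

text \<open>Optional stopping at a bounded time, by induction: from \<open>m\<close> to
  \<open>Suc m\<close> the stopped process moves only where \<open>tau S k\<close> exceeds
  \<open>m\<close>. That event belongs to \<open>F m\<close>, so \<open>martingale_step\<close>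
  applies on it.\<close>

lemma nn_integral_stopped: "(\<integral>\<^sup>+\<omega>. ennreal (stopped k m \<omega>) \<partial>M) = ennreal x"
proof (induction m)
  case 0
  have "stopped k 0 = S 0" by (auto simp: stopped_def fun_eq_iff split: enat.split)
  then show ?case by (simp add: nn_integral_start)
next
  case (Suc m)
  let ?A = "{\<omega>\<in>space M. tau S k \<omega> \<le> enat m}"
  let ?B = "space M - ?A"
  have split: "(\<integral>\<^sup>+\<omega>. f \<omega> \<partial>M) = (\<integral>\<^sup>+\<omega>\<in>?A. f \<omega> \<partial>M) + (\<integral>\<^sup>+\<omega>\<in>?B. f \<omega> \<partial>M)"
    if [measurable]: "f \<in> borel_measurable M" for f :: "'w \<Rightarrow> ennreal"
    by (subst nn_integral_add[symmetric]) (auto intro!: nn_integral_cong simp: indicator_def)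
  have "?B \<in> sets (F m)"
    using sets.compl_sets[OF tau_le_sets[of k m]] by simp
  note step = martingale_step[OF this]
  have "(\<integral>\<^sup>+\<omega>. ennreal (stopped k (Suc m) \<omega>) \<partial>M)
      = (\<integral>\<^sup>+\<omega>\<in>?A. ennreal (stopped k m \<omega>) \<partial>M) + (\<integral>\<^sup>+\<omega>\<in>?B. ennreal (S (Suc m) \<omega>) \<partial>M)"
    by (subst split, simp)
       (intro arg_cong2[where f="(+)"] nn_integral_cong, auto simp: indicator_def stopped_Suc)
  also have "\<dots> = (\<integral>\<^sup>+\<omega>\<in>?A. ennreal (stopped k m \<omega>) \<partial>M) + (\<integral>\<^sup>+\<omega>\<in>?B. ennreal (stopped k m \<omega>) \<partial>M)"
    unfolding step
    by (intro arg_cong2[where f="(+)"] nn_integral_cong refl) (auto simp: indicator_def stopped_before)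
  also have "\<dots> = (\<integral>\<^sup>+\<omega>. ennreal (stopped k m \<omega>) \<partial>M)"
    by (rule split[symmetric]) simp
  finally show ?case using Suc by simp
qed

section \<open>Growth of the chain under weighting by \<open>S\<close>\<close>

lemma b_fun_nonneg: "0 < z \<Longrightarrow> 0 \<le> b_fun K \<epsilon> z"
  unfolding b_fun_def set_lebesgue_integral_def
  by (intro Bochner_Integration.integral_nonneg) (auto simp: indicator_def)

text \<open>The mean of \<open>K z\<close> is \<open>z\<close>, and steps below
  \<open>z * (1 + \<epsilon>)\<close> contribute \<open>b_fun K \<epsilon> z * z\<close> to it. The
  remaining share says that under the kernel tilted by \<open>y / z\<close> the jump succeeds with
  probability \<open>1 - b_fun K \<epsilon> z\<close>.\<close>

lemma jump_mass:
  assumes z: "0 < z"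
  shows "(\<integral>\<^sup>+y\<in>{z * (1 + \<epsilon>)..}. ennreal y \<partial>K z) = ennreal (1 - b_fun K \<epsilon> z) * ennreal z"
proof -
  have [measurable]: "(\<lambda>y. y) \<in> borel_measurable (K z)" "{z * (1 + \<epsilon>)..} \<inter> {0<..} \<in> sets (K z)"
      "{0<..<z * (1 + \<epsilon>)} \<in> sets (K z)"
    by (simp_all add: measurable_cong_sets[OF sets_K[OF z] refl] measurable_restrict_space1
        sets_K[OF z] sets_restrict_space_iff greaterThanLessThan_eq)
  have id: "integrable (K z) (\<lambda>y. y)" "(LINT y|K z. y) = z"
    using kernel z unfolding martingale_kernel_def by (auto simp: has_bochner_integral_iff)
  let ?U = "{z * (1 + \<epsilon>)..} \<inter> {0<..}" and ?L = "{0<..<z * (1 + \<epsilon>)}"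
  have int: "integrable (K z) (\<lambda>y. indicator A y * y)" if "A \<in> sets (K z)" for A
    using integrable_mult_indicator[OF that id(1)] by simp
  have "(LINT y|K z. y) = (LINT y|K z. indicator ?U y * y + indicator ?L y * y)"
    by (intro Bochner_Integration.integral_cong) (auto simp: space_K[OF z] indicator_def)
  also have "\<dots> = (LINT y|K z. indicator ?U y * y) + (LINT y|K z. indicator ?L y * y)"
    by (intro Bochner_Integration.integral_add int) auto
  also have "(LINT y|K z. indicator ?L y * y) = b_fun K \<epsilon> z * z"
    using z by (simp add: b_fun_def set_lebesgue_integral_def)
  finally have U: "(LINT y|K z. indicator ?U y * y) = (1 - b_fun K \<epsilon> z) * z"
    by (simp add: id(2) left_diff_distrib)
  have "(\<integral>\<^sup>+y\<in>{z * (1 + \<epsilon>)..}. ennreal y \<partial>K z) = (\<integral>\<^sup>+y. ennreal (indicator ?U y * y) \<partial>K z)"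
    by (intro nn_integral_cong) (auto simp: space_K[OF z] indicator_def)
  also have "\<dots> = ennreal ((1 - b_fun K \<epsilon> z) * z)"
    unfolding U[symmetric]
    by (intro nn_integral_eq_integral int) (auto simp: indicator_def)
  also have "\<dots> = ennreal (1 - b_fun K \<epsilon> z) * ennreal z"
    using z by (simp add: ennreal_mult'')
  finally show ?thesis .
qed

text \<open>After \<open>i\<close> successful jumps the state exceeds
  \<open>y0 * (1 + \<epsilon>) ^ i\<close>, so the next tilted jump fails with probability at most
  \<open>\<beta> i\<close>; each step thus costs at most a factor \<open>1 - \<beta> i\<close> of
  the weighted mass. Measurability of \<open>B i\<close> is carried in the induction since the
  transition formula needs it.\<close>

lemma geometric_growth:
  assumes G: "G \<in> sets (F n)" and start: "\<And>\<omega>. \<omega> \<in> G \<Longrightarrow> y0 < S n \<omega>"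
    and "0 < \<epsilon>" "0 < y0"
    and b: "\<And>i z. y0 * (1 + \<epsilon>) ^ i < z \<Longrightarrow> b_fun K \<epsilon> z \<le> \<beta> i"
  defines "B \<equiv> \<lambda>i. {\<omega>\<in>G. \<forall>j<i. S (n + j) \<omega> * (1 + \<epsilon>) \<le> S (n + Suc j) \<omega>}"
  shows "B i \<in> sets (F (n + i)) \<and>
    (\<Prod>j<i. ennreal (1 - \<beta> j)) * (\<integral>\<^sup>+\<omega>\<in>G. ennreal (S n \<omega>) \<partial>M) \<le> (\<integral>\<^sup>+\<omega>\<in>B i. ennreal (S (n + i) \<omega>) \<partial>M)"
proof (induction i)
  case 0
  show ?case using G by (simp add: B_def)
next
  case (Suc i)
  have Gs: "G \<subseteq> space M" using sets.sets_into_space[OF G] by simp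
  have B_Suc: "B (Suc i) = B i \<inter> {\<omega>\<in>space M. S (n + i) \<omega> * (1 + \<epsilon>) \<le> S (n + Suc i) \<omega>}"
    using Gs by (auto simp: B_def less_Suc_eq)
  \<comment> \<open>The level reached by consecutive jumps, which makes the hypothesis on
    \<open>\<beta> i\<close> applicable at the current state.\<close>
  have low: "y0 * (1 + \<epsilon>) ^ i < S (n + i) \<omega>" if "\<omega> \<in> B i" for \<omega>
  proof -
    have "y0 * (1 + \<epsilon>) ^ j < S (n + j) \<omega>" if "j \<le> i" for j
      using that
    proof (induction j)
      case 0
      show ?case using start \<open>\<omega> \<in> B i\<close> by (simp add: B_def)
    next
      case (Suc j)
      then have "y0 * (1 + \<epsilon>) ^ j * (1 + \<epsilon>) < S (n + j) \<omega> * (1 + \<epsilon>)"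
        using assms(3) by (intro mult_strict_right_mono) auto
      also have "\<dots> \<le> S (n + Suc j) \<omega>"
        using \<open>\<omega> \<in> B i\<close> Suc.prems by (simp add: B_def)
      finally show ?case by (simp add: mult_ac)
    qed
    then show ?thesis by simp
  qed
  have Bi: "B i \<in> sets (F (n + i))" using Suc by simp
  have "B (Suc i) \<in> sets (F (n + Suc i))"
  proof -
    have [measurable]: "S (n + i) \<in> borel_measurable (F (n + Suc i))"
        "S (n + Suc i) \<in> borel_measurable (F (n + Suc i))"
      by (auto intro!: S_measurable_F)
    have "{\<omega>\<in>space (F (n + Suc i)). S (n + i) \<omega> * (1 + \<epsilon>) \<le> S (n + Suc i) \<omega>} \<in> sets (F (n + Suc i))"
      by measurable
    then show ?thesis
      unfolding B_Suc using Bi natural_filtration_mono[of "n + i" "n + Suc i" M S] by auto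
  qed
  moreover have "(\<Prod>j<Suc i. ennreal (1 - \<beta> j)) * (\<integral>\<^sup>+\<omega>\<in>G. ennreal (S n \<omega>) \<partial>M)
      \<le> (\<integral>\<^sup>+\<omega>\<in>B (Suc i). ennreal (S (n + Suc i) \<omega>) \<partial>M)"
  proof -
    have [measurable]: "(\<lambda>y. y) \<in> borel_measurable pos_borel"
      by (simp add: measurable_restrict_space1)
    have [measurable]: "B i \<in> sets M" by (rule sets_F[OF Bi])
    have "(\<Prod>j<Suc i. ennreal (1 - \<beta> j)) * (\<integral>\<^sup>+\<omega>\<in>G. ennreal (S n \<omega>) \<partial>M)
        \<le> ennreal (1 - \<beta> i) * (\<integral>\<^sup>+\<omega>\<in>B i. ennreal (S (n + i) \<omega>) \<partial>M)"
      using Suc by (auto simp: mult.assoc mult.left_commute[of _ "ennreal (1 - \<beta> i)"] intro!: mult_left_mono)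
    also have "\<dots> = (\<integral>\<^sup>+\<omega>\<in>B i. ennreal (1 - \<beta> i) * ennreal (S (n + i) \<omega>) \<partial>M)"
      by (subst nn_integral_cmult[symmetric]) (auto simp: mult.assoc)
    \<comment> \<open>\<open>jump_mass\<close> is used pointwise at the state
      \<open>S (n + i) \<omega>\<close>; afterwards the transition formula turns the inner kernel
      integral into the next state of the chain.\<close>
    also have "\<dots> \<le> (\<integral>\<^sup>+\<omega>\<in>B i. (\<integral>\<^sup>+y\<in>{S (n + i) \<omega> * (1 + \<epsilon>)..}. ennreal y \<partial>K (S (n + i) \<omega>)) \<partial>M)"
    proof (rule nn_integral_mono)
      fix \<omega> assume "\<omega> \<in> space M"
      then show "ennreal (1 - \<beta> i) * ennreal (S (n + i) \<omega>) * indicator (B i) \<omega>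
          \<le> (\<integral>\<^sup>+y\<in>{S (n + i) \<omega> * (1 + \<epsilon>)..}. ennreal y \<partial>K (S (n + i) \<omega>)) * indicator (B i) \<omega>"
        using b[OF low, of \<omega>]
        by (cases "\<omega> \<in> B i") (auto simp: jump_mass S_pos intro!: mult_right_mono ennreal_leI)
    qed
    also have "\<dots> = (\<integral>\<^sup>+\<omega>\<in>B i. ennreal (S (Suc (n + i)) \<omega>)
        * indicator {S (n + i) \<omega> * (1 + \<epsilon>)..} (S (Suc (n + i)) \<omega>) \<partial>M)"
      by (rule nn_integral_transition[OF Bi, symmetric, of "\<lambda>z y. ennreal y * indicator {z * (1 + \<epsilon>)..} y"])
         (auto simp: indicator_def[abs_def] split_beta')
    also have "\<dots> = (\<integral>\<^sup>+\<omega>\<in>B (Suc i). ennreal (S (n + Suc i) \<omega>) \<partial>M)"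
      by (intro nn_integral_cong) (auto simp: B_Suc indicator_def)
    finally show ?thesis .
  qed
  ultimately show ?case by blast
qed

section \<open>Almost sure occurrence of a down step\<close>

lemma emeasure_up_le:
  assumes z: "0 < z" and "c \<le> down_prob K z"
  shows "emeasure (K z) {z..} \<le> ennreal (1 - c)"
proof -
  interpret k: prob_space "K z" by (rule K_prob[OF z])
  have "{0<..<z} \<in> sets (K z)"
    by (auto simp: sets_K[OF z] sets_restrict_space)
  then have "k.prob (space (K z) - {0<..<z}) = 1 - down_prob K z"
    by (simp add: k.prob_compl down_prob_def)
  moreover have "space (K z) - {0<..<z} = {z..}"
    using z by (auto simp: space_K)
  ultimately show ?thesis
    using assms(2) by (auto simp: k.emeasure_eq_measure intro: ennreal_leI)
qed

text \<open>As long as a path from \<open>G\<close> has not fallen and stays at most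
  \<open>Y\<close>, it lies in \<open>{xa..Y}\<close>, where each further step avoids falling with
  probability at most \<open>1 - c\<close>. Surviving \<open>i\<close> such steps has probability at
  most \<open>(1 - c) ^ i\<close>, which tends to 0.\<close>

lemma bounded_increase_null:
  assumes G: "G \<in> sets (F n)" and start: "\<And>\<omega>. \<omega> \<in> G \<Longrightarrow> xa \<le> S n \<omega>"
    and "0 < c" and c: "\<And>z. xa \<le> z \<Longrightarrow> z \<le> Y \<Longrightarrow> c \<le> down_prob K z"
  shows "AE \<omega> in M. \<omega> \<in> G \<longrightarrow> (\<forall>m\<ge>n. S m \<omega> \<le> S (Suc m) \<omega>) \<longrightarrow> (\<exists>m\<ge>n. Y < S m \<omega>)"
proof (cases "c \<le> 1")
  case c1: True
  define H where "H i = {\<omega>\<in>G. \<forall>j<i. S (n + j) \<omega> \<le> S (n + Suc j) \<omega> \<and> S (n + j) \<omega> \<le> Y}" for i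
  have Gs: "G \<subseteq> space M" using sets.sets_into_space[OF G] by simp
  have H: "H i \<in> sets (F (n + i)) \<and> emeasure M (H i) \<le> ennreal (1 - c) ^ i" for i
  proof (induction i)
    case 0
    show ?case using G by (simp add: H_def emeasure_le_1)
  next
    case (Suc i)
    let ?Q = "{\<omega>\<in>space M. S (n + i) \<omega> \<le> Y}"
    have H_Suc: "H (Suc i) = (H i \<inter> ?Q) \<inter> {\<omega>\<in>space M. S (n + i) \<omega> \<le> S (n + Suc i) \<omega>}"
      using Gs by (auto simp: H_def less_Suc_eq)
    \<comment> \<open>Nondecreasing steps preserve the lower bound \<open>xa\<close>, so the lower
      bound \<open>c\<close> on the down probability stays available.\<close>
    have low: "xa \<le> S (n + i) \<omega>" if "\<omega> \<in> H i" for \<omega>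
    proof -
      have "xa \<le> S (n + j) \<omega>" if "j \<le> i" for j
        using that
      proof (induction j)
        case (Suc j)
        then have "xa \<le> S (n + j) \<omega>" "S (n + j) \<omega> \<le> S (n + Suc j) \<omega>"
          using \<open>\<omega> \<in> H i\<close> by (simp_all add: H_def Suc_le_eq del: add_Suc_right)
        then show ?case by simp
      qed (use start \<open>\<omega> \<in> H i\<close> in \<open>simp add: H_def\<close>)
      then show ?thesis by simp
    qed
    have HQ: "H i \<inter> ?Q \<in> sets (F (n + i))"
    proof -
      have [measurable]: "S (n + i) \<in> borel_measurable (F (n + i))" by (auto intro!: S_measurable_F)
      have "{\<omega>\<in>space (F (n + i)). S (n + i) \<omega> \<le> Y} \<in> sets (F (n + i))" by measurable
      then show ?thesis using Suc by auto
    qed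
    have sets: "H (Suc i) \<in> sets (F (n + Suc i))"
    proof -
      have [measurable]: "S (n + i) \<in> borel_measurable (F (n + Suc i))"
          "S (n + Suc i) \<in> borel_measurable (F (n + Suc i))"
        by (auto intro!: S_measurable_F)
      have "{\<omega>\<in>space (F (n + Suc i)). S (n + i) \<omega> \<le> S (n + Suc i) \<omega>} \<in> sets (F (n + Suc i))"
        by measurable
      then show ?thesis
        unfolding H_Suc using HQ natural_filtration_mono[of "n + i" "n + Suc i" M S] by auto
    qed
    have [measurable]: "(\<lambda>y. y) \<in> borel_measurable pos_borel"
      by (simp add: measurable_restrict_space1)
    have [measurable]: "H i \<inter> ?Q \<in> sets M" "H i \<in> sets M" "H (Suc i) \<in> sets M"
      using sets_F[OF HQ] sets_F[OF sets] sets_F Suc by auto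
    have "emeasure M (H (Suc i)) = (\<integral>\<^sup>+\<omega>. indicator (H (Suc i)) \<omega> \<partial>M)"
      by simp
    also have "\<dots> = (\<integral>\<^sup>+\<omega>\<in>H i \<inter> ?Q. indicator {S (n + i) \<omega>..} (S (Suc (n + i)) \<omega>) \<partial>M)"
      by (intro nn_integral_cong) (auto simp: H_Suc indicator_def)
    also have "\<dots> = (\<integral>\<^sup>+\<omega>\<in>H i \<inter> ?Q. (\<integral>\<^sup>+y. indicator {S (n + i) \<omega>..} y \<partial>K (S (n + i) \<omega>)) \<partial>M)"
      by (rule nn_integral_transition[OF HQ, of "\<lambda>z y. indicator {z..} y"])
         (auto simp: indicator_def[abs_def] split_beta')
    also have "\<dots> \<le> (\<integral>\<^sup>+\<omega>. ennreal (1 - c) * indicator (H i) \<omega> \<partial>M)"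
    proof (rule nn_integral_mono)
      fix \<omega> assume w: "\<omega> \<in> space M"
      have "{S (n + i) \<omega>..} \<in> sets (K (S (n + i) \<omega>))"
        using S_pos[OF w, of "n + i"] by (auto simp: sets_K sets_restrict_space intro!: image_eqI[of _ _ "{S (n + i) \<omega>..}"])
      then have "(\<integral>\<^sup>+y. indicator {S (n + i) \<omega>..} y \<partial>K (S (n + i) \<omega>)) = emeasure (K (S (n + i) \<omega>)) {S (n + i) \<omega>..}"
        by (rule nn_integral_indicator)
      then show "(\<integral>\<^sup>+y. indicator {S (n + i) \<omega>..} y \<partial>K (S (n + i) \<omega>)) * indicator (H i \<inter> ?Q) \<omega>
          \<le> ennreal (1 - c) * indicator (H i) \<omega>"
        using emeasure_up_le[OF S_pos[OF w] c[OF low]]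
        by (cases "\<omega> \<in> H i \<and> S (n + i) \<omega> \<le> Y") (auto simp: w)
    qed
    also have "\<dots> = ennreal (1 - c) * emeasure M (H i)"
      by (simp add: nn_integral_cmult_indicator)
    also have "\<dots> \<le> ennreal (1 - c) ^ Suc i"
      using Suc by (auto intro!: mult_left_mono)
    finally show ?case using sets by blast
  qed
  have [measurable]: "H i \<in> sets M" for i using H[of i] sets_F by blast
  have "emeasure M (\<Inter>i. H i) = 0"
  proof -
    have "emeasure M (\<Inter>i. H i) \<le> ennreal ((1 - c) ^ i)" for i
      using H[of i] emeasure_mono[of "\<Inter>i. H i" "H i" M] c1
      by (auto simp: ennreal_power intro: order_trans)
    moreover have "(\<lambda>i. ennreal ((1 - c) ^ i)) \<longlonglongrightarrow> ennreal 0"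
      using c1 \<open>0 < c\<close> by (intro tendsto_ennrealI LIMSEQ_realpow_zero) auto
    ultimately have "emeasure M (\<Inter>i. H i) \<le> ennreal 0"
      by (intro LIMSEQ_le_const) auto
    then show ?thesis by simp
  qed
  then have "AE \<omega> in M. \<omega> \<notin> (\<Inter>i. H i)"
    by (intro AE_not_in) auto
  then show ?thesis
  proof eventually_elim
    case (elim \<omega>)
    show ?case
    proof (intro impI)
      assume w: "\<omega> \<in> G" and mono: "\<forall>m\<ge>n. S m \<omega> \<le> S (Suc m) \<omega>"
      obtain i where "\<omega> \<notin> H i" using elim by blast
      then obtain j where "\<not> (S (n + j) \<omega> \<le> S (n + Suc j) \<omega> \<and> S (n + j) \<omega> \<le> Y)"
        using w unfolding H_def by blast
      then show "\<exists>m\<ge>n. Y < S m \<omega>"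
        using mono by (intro exI[of _ "n + j"]) auto
    qed
  qed
next
  \<comment> \<open>If \<open>c\<close> exceeds 1, it cannot bound a probability from below, so no
    state reached on \<open>G\<close> at time \<open>n\<close> lies in \<open>{xa..Y}\<close>: the
    level is already passed.\<close>
  case False
  have "Y < S n \<omega>" if "\<omega> \<in> G" for \<omega>
  proof (rule ccontr)
    assume "\<not> Y < S n \<omega>"
    then have "c \<le> down_prob K (S n \<omega>)" using start[OF that] by (intro c) auto
    moreover have "\<omega> \<in> space M" using that sets.sets_into_space[OF G] by auto
    then have "down_prob K (S n \<omega>) \<le> 1"
      unfolding down_prob_def by (intro prob_space.prob_le_1 K_prob S_pos)
    ultimately show False using False by simp
  qed
  then show ?thesis by auto
qed

text \<open>A path from \<open>G\<close> without down steps would pass every level by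
  \<open>bounded_increase_null\<close>, yet almost surely such a path converges and is therefore
  bounded.\<close>

lemma AE_eventually_down:
  assumes G: "G \<in> sets (F n)" and start: "\<And>\<omega>. \<omega> \<in> G \<Longrightarrow> xa \<le> S n \<omega>" and "0 < xa"
    and down: "\<And>y. xa < y \<Longrightarrow> 0 < (INF z\<in>{xa..y}. down_prob K z)"
  shows "AE \<omega> in M. \<omega> \<in> G \<longrightarrow> (\<exists>m\<ge>n. S (Suc m) \<omega> < S m \<omega>)"
proof -
  \<comment> \<open>Countably many unbounded levels suffice, so the exceptional null sets can be
    united; \<open>Suc\<close> keeps each level strictly above \<open>xa\<close>, as
    \<open>down\<close> requires.\<close>
  have "AE \<omega> in M. \<omega> \<in> G \<longrightarrow> (\<forall>m\<ge>n. S m \<omega> \<le> S (Suc m) \<omega>) \<longrightarrow> (\<exists>m\<ge>n. xa + real (Suc Y) < S m \<omega>)"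
    for Y
  proof (rule bounded_increase_null[OF G start])
    let ?c = "INF z\<in>{xa..xa + real (Suc Y)}. down_prob K z"
    show "0 < ?c" by (rule down) simp
    show "?c \<le> down_prob K z" if "xa \<le> z" "z \<le> xa + real (Suc Y)" for z
      using that
      by (intro cINF_lower) (auto simp: down_prob_def intro!: bdd_belowI[of _ 0])
  qed
  then have "AE \<omega> in M. \<forall>Y. \<omega> \<in> G \<longrightarrow> (\<forall>m\<ge>n. S m \<omega> \<le> S (Suc m) \<omega>) \<longrightarrow> (\<exists>m\<ge>n. xa + real (Suc Y) < S m \<omega>)"
    by (subst AE_all_countable) blast
  with AE_convergent_if_eventually_incseq show ?thesis
  proof eventually_elim
    case (elim \<omega>)
    show ?case
    proof (rule impI, rule ccontr)
      assume w: "\<omega> \<in> G" and "\<not> (\<exists>m\<ge>n. S (Suc m) \<omega> < S m \<omega>)"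
      then have mono: "\<forall>m\<ge>n. S m \<omega> \<le> S (Suc m) \<omega>" by (auto simp: not_less)
      then have "convergent (\<lambda>m. S m \<omega>)" using elim(1) by blast
      then obtain C where C: "\<And>m. \<bar>S m \<omega>\<bar> \<le> C"
        using convergent_imp_Bseq[of "\<lambda>m. S m \<omega>"] by (auto simp: Bseq_def)
      obtain Y :: nat where "C \<le> real Y" using real_arch_simple by blast
      moreover obtain m where "xa + real (Suc Y) < S m \<omega>" using elim(2) w mono by blast
      ultimately show False using C[of m] \<open>0 < xa\<close> by simp
    qed
  qed
qed

section \<open>Loss of expectation in the limit\<close>

text \<open>A finite down time freezes the stopped path. Otherwise convergence must be assumed,
  since \<open>lim\<close> is the actual limit only for convergent sequences.\<close>

lemma stopped_tendsto_value_at: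
  assumes "convergent (\<lambda>m. S m \<omega>) \<or> tau S k \<omega> \<noteq> \<infinity>"
  shows "(\<lambda>m. stopped k m \<omega>) \<longlonglongrightarrow> value_at S (tau S k) \<omega>"
proof (cases "tau S k \<omega>")
  case (enat j)
  show ?thesis
    by (rule tendsto_eventually, rule eventually_sequentiallyI[of j])
       (simp add: enat stopped_def value_at_def min_def)
next
  case infinity
  with assms show ?thesis
    by (simp add: stopped_def value_at_def S_infty_def convergent_LIMSEQ_iff)
qed

text \<open>At every time \<open>n + i\<close> the part of \<open>G\<close> not yet stopped carries
  at least \<open>c\<close> of the constant total \<open>x\<close>. These parts eventually exclude
  almost every path, so removing them does not change the pointwise limit, but it lowers each
  expectation to at most \<open>x - c\<close>; Fatou's lemma passes this to the limit.\<close>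

lemma expectation_loss:
  assumes G: "G \<in> sets (F n)"
    and finite: "AE \<omega> in M. \<omega> \<in> G \<longrightarrow> tau S k \<omega> \<noteq> \<infinity>"
    and escape: "\<And>i. c \<le> (\<integral>\<^sup>+\<omega>\<in>{\<omega>\<in>G. \<not> tau S k \<omega> \<le> enat (n + i)}. ennreal (S (n + i) \<omega>) \<partial>M)"
  shows "(\<integral>\<^sup>+\<omega>. ennreal (value_at S (tau S k) \<omega>) \<partial>M) \<le> ennreal x - c"
proof -
  define E where "E i = {\<omega>\<in>G. \<not> tau S k \<omega> \<le> enat (n + i)}" for i
  have [measurable]: "G \<in> sets M" by (rule sets_F[OF G])
  have Gs: "G \<subseteq> space M" using sets.sets_into_space[OF G] by simp
  have E_alt: "E i = G \<inter> {\<omega>\<in>space M. \<not> tau S k \<omega> \<le> enat (n + i)}" for i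
    using Gs by (auto simp: E_def)
  have [measurable]: "E i \<in> sets M" for i
    unfolding E_alt by measurable
  \<comment> \<open>\<open>V i\<close> is the stopped process with the escaping part
    \<open>E i\<close> cut away.\<close>
  define V where "V i \<omega> = ennreal (stopped k (n + i) \<omega>) * indicator (space M - E i) \<omega>" for i \<omega>
  have [measurable]: "V i \<in> borel_measurable M" for i
    unfolding V_def by measurable
  have V_le: "(\<integral>\<^sup>+\<omega>. V i \<omega> \<partial>M) \<le> ennreal x - c" for i
  proof -
    have "ennreal x = (\<integral>\<^sup>+\<omega>. ennreal (stopped k (n + i) \<omega>) \<partial>M)"
      by (rule nn_integral_stopped[symmetric])
    also have "\<dots> = (\<integral>\<^sup>+\<omega>. V i \<omega> + ennreal (S (n + i) \<omega>) * indicator (E i) \<omega> \<partial>M)"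
      by (intro nn_integral_cong) (auto simp: V_def indicator_def E_def stopped_before)
    also have "\<dots> = (\<integral>\<^sup>+\<omega>. V i \<omega> \<partial>M) + (\<integral>\<^sup>+\<omega>\<in>E i. ennreal (S (n + i) \<omega>) \<partial>M)"
      by (rule nn_integral_add) auto
    finally have eq: "ennreal x = (\<integral>\<^sup>+\<omega>. V i \<omega> \<partial>M) + (\<integral>\<^sup>+\<omega>\<in>E i. ennreal (S (n + i) \<omega>) \<partial>M)" .
    then have "(\<integral>\<^sup>+\<omega>. V i \<omega> \<partial>M) + c \<le> ennreal x"
      using escape[of i] by (auto simp: E_def[symmetric] intro!: add_left_mono)
    then show ?thesis
      by (metis ennreal_add_diff_cancel_right ennreal_minus_mono ennreal_neq_top neq_top_trans
          add.commute le_iff_add order_refl)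
  qed
  have "AE \<omega> in M. ennreal (value_at S (tau S k) \<omega>) \<le> liminf (\<lambda>i. V i \<omega>)"
    using AE_convergent_if_eventually_incseq finite AE_space
  proof eventually_elim
    case (elim \<omega>)
    \<comment> \<open>If the down time is infinite, the path is eventually nondecreasing, hence
      almost surely convergent.\<close>
    have "convergent (\<lambda>m. S m \<omega>) \<or> tau S k \<omega> \<noteq> \<infinity>"
      using elim(1) tau_infty_eventually_incseq[of S k \<omega>] by blast
    then have "(\<lambda>i. stopped k (i + n) \<omega>) \<longlonglongrightarrow> value_at S (tau S k) \<omega>"
      by (intro LIMSEQ_ignore_initial_segment stopped_tendsto_value_at)
    then have lim: "(\<lambda>i. ennreal (stopped k (n + i) \<omega>)) \<longlonglongrightarrow> ennreal (value_at S (tau S k) \<omega>)"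
      by (intro tendsto_ennrealI) (simp add: add.commute)
    have "\<exists>N. \<forall>i\<ge>N. \<omega> \<notin> E i"
    proof (cases "\<omega> \<in> G")
      case True
      then obtain j where "tau S k \<omega> = enat j" using elim(2) by auto
      then show ?thesis by (intro exI[of _ j]) (auto simp: E_def)
    qed (simp add: E_def)
    then have "\<forall>\<^sub>F i in sequentially. ennreal (stopped k (n + i) \<omega>) = V i \<omega>"
      using elim(3) unfolding eventually_sequentially V_def by (elim exE) (intro exI, auto)
    with lim have "(\<lambda>i. V i \<omega>) \<longlonglongrightarrow> ennreal (value_at S (tau S k) \<omega>)"
      by (rule Lim_transform_eventually)
    then show ?case by (simp add: lim_imp_Liminf)
  qed
  then have "(\<integral>\<^sup>+\<omega>. ennreal (value_at S (tau S k) \<omega>) \<partial>M) \<le> (\<integral>\<^sup>+\<omega>. liminf (\<lambda>i. V i \<omega>) \<partial>M)"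
    by (rule nn_integral_mono_AE)
  also have "\<dots> \<le> liminf (\<lambda>i. \<integral>\<^sup>+\<omega>. V i \<omega> \<partial>M)"
    by (rule nn_integral_liminf) simp
  also have "\<dots> \<le> liminf (\<lambda>i::nat. ennreal x - c)"
    by (intro Liminf_mono always_eventually allI V_le)
  also have "\<dots> = ennreal x - c"
    by (simp add: Liminf_const)
  finally show ?thesis .
qed

section \<open>Choice of the level, the time and the number of down times\<close>

lemma bubble_if_unbounded:
  assumes "0 < xa" and down: "\<And>y. xa < y \<Longrightarrow> 0 < (INF z\<in>{xa..y}. down_prob K z)"
    and "0 < \<epsilon>" "0 < xb" and anti: "antimono_on {xb..} (b_fun K \<epsilon>)"
    and fin: "(\<integral>\<^sup>+u\<in>{ln xb..}. ennreal (b_fun K \<epsilon> (exp u)) \<partial>lborel) < \<infinity>"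
    and unbounded: "\<not> as_bounded M S"
  shows "bubble M S"
proof -
  define z where "z i = xb * (1 + \<epsilon>) ^ Suc i" for i
  have z_ge: "xb \<le> z i" for i
    using assms(3,4) by (simp add: z_def mult_le_cancel_left1 one_le_power del: power_Suc)
  have nonneg: "0 \<le> b_fun K \<epsilon> (z i)" for i
    using z_ge[of i] assms(4) by (intro b_fun_nonneg) simp
  have summ: "summable (\<lambda>i. b_fun K \<epsilon> (z i))"
    unfolding z_def
    by (rule summable_geometric_samples[OF assms(3,4) anti _ fin]) (use assms(4) in \<open>auto intro: b_fun_nonneg\<close>)
  \<comment> \<open>Beyond \<open>N\<close> the failure probabilities sum to less than 1/2, so the
    product of the success probabilities stays at least 1/2.\<close>
  obtain N where N: "\<And>m n. N \<le> m \<Longrightarrow> \<bar>\<Sum>i=m..<n. b_fun K \<epsilon> (z i)\<bar> < 1 / 2"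
    using summ unfolding summable_Cauchy by (metis half_gt_zero_iff real_norm_def zero_less_one)
  define \<beta> where "\<beta> i = b_fun K \<epsilon> (z (N + i))" for i
  have \<beta>_sum: "(\<Sum>j<i. \<beta> j) \<le> 1 / 2" for i
  proof -
    have "(\<Sum>j<i. \<beta> j) = (\<Sum>j=N..<N + i. b_fun K \<epsilon> (z j))"
      unfolding \<beta>_def using sum.shift_bounds_nat_ivl[of "\<lambda>j. b_fun K \<epsilon> (z j)" 0 N i]
      by (simp add: lessThan_atLeast0 add.commute)
    then show ?thesis using N[of N "N + i"] by simp
  qed
  have \<beta>_nonneg: "0 \<le> \<beta> i" for i unfolding \<beta>_def by (rule nonneg)
  have \<beta>_le: "\<beta> i \<le> 1" for i
  proof -
    have "\<beta> i \<le> (\<Sum>j<Suc i. \<beta> j)"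
      using \<beta>_nonneg by (intro member_le_sum) auto
    with \<beta>_sum[of "Suc i"] show ?thesis by simp
  qed
  \<comment> \<open>Being at least \<open>xa\<close> makes a down step certain; being at least
    \<open>z N\<close> lets the geometric level after \<open>i\<close> jumps dominate
    \<open>z (N + i)\<close>, where \<open>b_fun\<close> equals \<open>\<beta> i\<close>.\<close>
  define y0 where "y0 = max xa (z N)"
  have y0: "0 < y0" "xa \<le> y0" "z N \<le> y0" using assms(1) by (auto simp: y0_def)
  have b_le: "b_fun K \<epsilon> v \<le> \<beta> i" if "y0 * (1 + \<epsilon>) ^ i < v" for i v
  proof -
    have "z (N + i) = z N * (1 + \<epsilon>) ^ i"
      by (simp add: z_def power_add mult_ac)
    also have "\<dots> \<le> y0 * (1 + \<epsilon>) ^ i"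
      using y0(3) assms(3) by (intro mult_right_mono) auto
    finally have "z (N + i) \<le> v" using that by simp
    then show ?thesis
      unfolding \<beta>_def using monotone_onD[OF anti, of "z (N + i)" v] z_ge[of "N + i"] by auto
  qed
  \<comment> \<open>The Weierstrass inequality bounds a product of factors
    \<open>1 - \<beta> j\<close> with all \<open>\<beta> j\<close> in [0,1] below by one minus the
    sum.\<close>
  have half: "ennreal (1 / 2) \<le> (\<Prod>j<i. ennreal (1 - \<beta> j))" for i
  proof -
    have "1 / 2 \<le> 1 - (\<Sum>j<i. \<beta> j)" using \<beta>_sum[of i] by simp
    also have "\<dots> \<le> (\<Prod>j<i. 1 - \<beta> j)"
      by (rule Weierstrass_prod_ineq) (use \<beta>_nonneg \<beta>_le in auto)
    finally show ?thesis using \<beta>_le by (subst prod_ennreal) (auto intro: ennreal_leI simp del: ennreal_half)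
  qed
  \<comment> \<open>If every \<open>S n\<close> were almost surely at most \<open>y0\<close>, the
    countable intersection would make \<open>y0\<close> an almost sure bound for the whole
    path.\<close>
  obtain n where n: "\<not> (AE \<omega> in M. S n \<omega> \<le> y0)"
    using unbounded AE_all_countable[of "\<lambda>k \<omega>. S k \<omega> \<le> y0" M] unfolding as_bounded_def by blast
  \<comment> \<open>On \<open>G j\<close> the level is exceeded at time \<open>n\<close> after
    exactly \<open>j\<close> down times. The sets \<open>G j\<close> cover the event
    \<open>y0 < S n \<omega>\<close>, so one of them is not null, and \<open>Suc j\<close> is the
    index at which expectation is lost.\<close>
  define G where "G j = {\<omega>\<in>space M. y0 < S n \<omega> \<and> tau S j \<omega> \<le> enat n \<and> \<not> tau S (Suc j) \<omega> \<le> enat n}" for j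
  have "\<exists>j. \<not> (AE \<omega> in M. \<omega> \<notin> G j)"
  proof (rule ccontr)
    assume "\<not> ?thesis"
    then have "AE \<omega> in M. \<forall>j. \<omega> \<notin> G j" by (simp add: AE_all_countable)
    then have "AE \<omega> in M. S n \<omega> \<le> y0"
      using AE_space
    proof eventually_elim
      case (elim \<omega>)
      obtain j where "tau S j \<omega> \<le> enat n" "\<not> tau S (Suc j) \<omega> \<le> enat n"
        using tau_interval_exists[of S \<omega> n] by blast
      moreover have "\<omega> \<notin> G j" using elim(1) by (rule spec)
      ultimately show ?case
        using elim(2) unfolding G_def by (simp add: not_less)
    qed
    with n show False ..
  qed
  then obtain j where j: "\<not> (AE \<omega> in M. \<omega> \<notin> G j)" ..
  have G_sets: "G j \<in> sets (F n)"
  proof -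
    have [measurable]: "S n \<in> borel_measurable (F n)" by (rule S_measurable_F) simp
    have "{\<omega>\<in>space (F n). y0 < S n \<omega>} \<in> sets (F n)" by measurable
    moreover have "G j = {\<omega>\<in>space (F n). y0 < S n \<omega>} \<inter> {\<omega>\<in>space M. tau S j \<omega> \<le> enat n}
        - {\<omega>\<in>space M. tau S (Suc j) \<omega> \<le> enat n}"
      by (auto simp: G_def)
    ultimately show ?thesis using tau_le_sets by auto
  qed
  have [measurable]: "G j \<in> sets M" by (rule sets_F[OF G_sets])
  \<comment> \<open>Half of the weighted mass of \<open>G j\<close>; it is positive because
    \<open>S n\<close> is positive and \<open>G j\<close> is not null.\<close>
  define c where "c = ennreal (1 / 2) * (\<integral>\<^sup>+\<omega>\<in>G j. ennreal (S n \<omega>) \<partial>M)"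
  have "(\<integral>\<^sup>+\<omega>\<in>G j. ennreal (S n \<omega>) \<partial>M) \<noteq> 0"
  proof
    assume "(\<integral>\<^sup>+\<omega>\<in>G j. ennreal (S n \<omega>) \<partial>M) = 0"
    then have "AE \<omega> in M. ennreal (S n \<omega>) * indicator (G j) \<omega> = 0"
      by (subst (asm) nn_integral_0_iff_AE) auto
    then have "AE \<omega> in M. \<omega> \<notin> G j"
      using AE_space
    proof eventually_elim
      case (elim \<omega>)
      then show ?case using S_pos[of \<omega> n] by (auto simp: ennreal_eq_0_iff split: split_indicator_asm)
    qed
    with j show False ..
  qed
  then have c_pos: "0 < c" by (simp add: c_def zero_less_iff_neq_zero)
  have "(\<integral>\<^sup>+\<omega>. ennreal (value_at S (tau S (Suc j)) \<omega>) \<partial>M) \<le> ennreal x - c"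
  proof (rule expectation_loss[OF G_sets])
    have "AE \<omega> in M. \<omega> \<in> G j \<longrightarrow> (\<exists>m\<ge>n. S (Suc m) \<omega> < S m \<omega>)"
      using G_sets y0(2) by (intro AE_eventually_down[OF _ _ assms(1) down]) (auto simp: G_def)
    then show "AE \<omega> in M. \<omega> \<in> G j \<longrightarrow> tau S (Suc j) \<omega> \<noteq> \<infinity>"
    proof eventually_elim
      case (elim \<omega>)
      show ?case
      proof
        assume w: "\<omega> \<in> G j"
        then obtain m where "n \<le> m" "S (Suc m) \<omega> < S m \<omega>" using elim by blast
        moreover from this w have "tau S j \<omega> \<le> enat m"
          by (auto simp: G_def intro: order_trans)
        ultimately have "tau S (Suc j) \<omega> \<le> enat (Suc m)"
          by (auto simp: tau_Suc_le_iff)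
        then show "tau S (Suc j) \<omega> \<noteq> \<infinity>" by (cases "tau S (Suc j) \<omega>") simp_all
      qed
    qed
    fix i
    let ?B = "{\<omega>\<in>G j. \<forall>l<i. S (n + l) \<omega> * (1 + \<epsilon>) \<le> S (n + Suc l) \<omega>}"
    have "c \<le> (\<Prod>l<i. ennreal (1 - \<beta> l)) * (\<integral>\<^sup>+\<omega>\<in>G j. ennreal (S n \<omega>) \<partial>M)"
      unfolding c_def by (intro mult_right_mono half) simp
    also have "\<dots> \<le> (\<integral>\<^sup>+\<omega>\<in>?B. ennreal (S (n + i) \<omega>) \<partial>M)"
      using geometric_growth[where \<beta>=\<beta> and i=i, OF G_sets _ assms(3) y0(1) b_le] by (simp add: G_def)
    also have "\<dots> \<le> (\<integral>\<^sup>+\<omega>\<in>{\<omega>\<in>G j. \<not> tau S (Suc j) \<omega> \<le> enat (n + i)}. ennreal (S (n + i) \<omega>) \<partial>M)"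
    proof (rule nn_integral_mono)
      fix \<omega> assume w: "\<omega> \<in> space M"
      \<comment> \<open>A down step before time \<open>n\<close> would contradict the count in
        \<open>G j\<close>, and from \<open>n\<close> on every step on \<open>?B\<close> multiplies
        the positive state by at least \<open>1 + \<epsilon>\<close>.\<close>
      have "\<not> tau S (Suc j) \<omega> \<le> enat (n + i)" if B: "\<omega> \<in> ?B"
      proof
        assume "tau S (Suc j) \<omega> \<le> enat (n + i)"
        then obtain m where m: "m < n + i" "tau S j \<omega> \<le> enat m" "S (Suc m) \<omega> < S m \<omega>"
          by (auto simp: tau_Suc_le_iff)
        show False
        proof (cases "m < n")
          case True
          then have "tau S (Suc j) \<omega> \<le> enat n" using m by (auto simp: tau_Suc_le_iff)
          then show False using B by (simp add: G_def)
        next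
          case False
          define l where "l = m - n"
          have l: "m = n + l" "l < i" using False m(1) by (auto simp: l_def)
          have "S m \<omega> \<le> S m \<omega> * (1 + \<epsilon>)" using S_pos[OF w] assms(3) by simp
          also have "\<dots> \<le> S (Suc m) \<omega>" using B l by auto
          finally show False using m(3) by simp
        qed
      qed
      then show "ennreal (S (n + i) \<omega>) * indicator ?B \<omega>
          \<le> ennreal (S (n + i) \<omega>) * indicator {\<omega>\<in>G j. \<not> tau S (Suc j) \<omega> \<le> enat (n + i)} \<omega>"
        by (auto simp: indicator_def)
    qed
    finally show "c \<le> (\<integral>\<^sup>+\<omega>\<in>{\<omega>\<in>G j. \<not> tau S (Suc j) \<omega> \<le> enat (n + i)}. ennreal (S (n + i) \<omega>) \<partial>M)" .
  qed
  \<comment> \<open>Strictness needs \<open>x\<close> finite and nonzero; the latter follows since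
    the mass of \<open>G j\<close> is positive and bounded by the expectation \<open>x\<close> of
    \<open>S n\<close>.\<close>
  also have "\<dots> < ennreal x"
  proof -
    have "(\<integral>\<^sup>+\<omega>\<in>G j. ennreal (S n \<omega>) \<partial>M) \<le> (\<integral>\<^sup>+\<omega>. ennreal (S n \<omega>) \<partial>M)"
      by (intro nn_integral_mono) (simp split: split_indicator)
    then have "ennreal x \<noteq> 0"
      using \<open>(\<integral>\<^sup>+\<omega>\<in>G j. ennreal (S n \<omega>) \<partial>M) \<noteq> 0\<close> unfolding nn_integral_S by (metis le_zero_eq)
    then show ?thesis
      using c_pos by (intro ennreal_between) (auto simp: zero_less_iff_neq_zero)
  qed
  also have "\<dots> = (\<integral>\<^sup>+\<omega>. ennreal (S 0 \<omega>) \<partial>M)"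
    by (rule nn_integral_start[symmetric])
  finally show ?thesis
    unfolding bubble_def by (intro exI[of _ "Suc j"]) simp
qed

end

theorem theorem2p5:
  fixes K :: "real \<Rightarrow> real measure"
    and P :: "real \<Rightarrow> 'w measure"
    and S :: "nat \<Rightarrow> 'w \<Rightarrow> real"
  assumes "martingale_kernel K"
    and "\<And>x. x > 0 \<Longrightarrow> markov_chain_from K x (P x) S"
    and "\<exists>xa>0. \<forall>y>xa. (INF x\<in>{xa..y}. down_prob K x) > 0"
    and "\<exists>\<epsilon>>0. \<exists>xb>0. antimono_on {xb..} (b_fun K \<epsilon>) \<and>
           (\<integral>\<^sup>+ u\<in>{ln xb..}. ennreal (b_fun K \<epsilon> (exp u)) \<partial>lborel) < \<infinity>"
  shows "\<forall>x>0. \<not> as_bounded (P x) S \<longrightarrow> bubble (P x) S"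
proof (intro allI impI)
  fix x :: real
  assume "x > 0" and unbounded: "\<not> as_bounded (P x) S"
  then have chain: "markov_chain_from K x (P x) S" using assms(2) by blast
  then interpret prob_space "P x" by (simp add: markov_chain_from_def)
  interpret markov_martingale "P x" K S x
    by unfold_locales (rule assms(1), rule chain)
  show "bubble (P x) S"
    using assms(3,4) bubble_if_unbounded[OF _ _ _ _ _ _ unbounded] by blast
qed

end
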